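(* Let $\mathbb{F}$ be an algebraically closed field of characteristic different from $2$, let $k\ge1$, $n=2k+1$, $m\ge0$, let $r$ satisfy $0\le 2r\le m$, and put $q=m-2r$. Let $\Gamma^r$ be the fine grading on the Heisenberg superalgebra $H_{n,m}$ whose homogeneous components are the lines spanned by the basis elements $z,e_i,\hat e_i,u_j,v_j,z_l$ ($i\le k$, $j\le r$, $l\le q$). Then the Weyl group $\mathcal{W}(\Gamma^r)$ is generated by $[\mu_1]$, $[\mu'_1]$, $\{[\tilde\sigma]:\sigma\in S_k\}$, $\{[\bar\sigma]:\sigma\in S_r\}$ and $\{[\hat\sigma]:\sigma\in S_q\}$.
   Context: $H_{n,m}$ is the Lie superalgebra with even part spanned by $z,e_1,\hat e_1,\dots,e_k,\hat e_k$ and odd part spanned by $u_1,v_1,\dots,u_r,v_r,z_1,\dots,z_q$ ($m=2r+q$), whose only nonzero products of basis elements are $[e_i,\hat e_i]=-[\hat e_i,e_i]=z$, $[u_j,v_j]=[v_j,u_j]=z$, $[z_l,z_l]=z$ (up to isomorphism this does not depend on $r$). The grading $\Gamma^r$ is the $\mathbb{Z}\times\mathbb{Z}^{k}\times\mathbb{Z}^r\times\mathbb{Z}_2^{q}$-grading with $\deg z=(2;0;0;\bar0)$, $\deg e_i=(1;\epsilon_i;0;\bar0)$, $\deg\hat e_i=(1;-\epsilon_i;0;\bar0)$, $\deg u_j=(1;0;\epsilon_j;\bar0)$, $\deg v_j=(1;0;-\epsilon_j;\bar 0)$, $\deg z_l=(1;0;0;\bar\epsilon_l)$, where $\epsilon_i$,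 $\bar\epsilon_l$ are the standard unit vectors. $\mathrm{Aut}(\Gamma^r)$ is the group of (parity-preserving) automorphisms of the superalgebra that permute the homogeneous components of $\Gamma^r$, $\mathrm{Stab}(\Gamma^r)$ is the subgroup of those leaving each homogeneous component invariant, $\mathcal{W}(\Gamma^r)=\mathrm{Aut}(\Gamma^r)/\mathrm{Stab}(\Gamma^r)$, and $[f]$ is the class of $f$. The following elements belong to $\mathrm{Aut}(\Gamma^r)$; basis elements not mentioned are fixed. For $\sigma\in S_k$: $\tilde\sigma(e_i)=e_{\sigma(i)}$, $\tilde\sigma(\hat e_i)=\hat e_{\sigma(i)}$. For $i\le k$: $\mu_i(e_i)=\hat e_i$, $\mu_i(\hat e_i)=-e_i$. For $\sigma\in S_r$: $\bar\sigma(u_i)=u_{\sigma(i)}$, $\bar\sigma(v_i)=v_{\sigma(i)}$. For $\rho\in S_q$: $\hat\rho(z_l)=z_{\rho(l)}$. For $i\le r$: $\mu'_i(u_i)=v_i$, $\mu'_i(v_i)=u_i$. (If $r=0$ the generator $[\mu_1']$ is absent.) *)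

theory Defs
  imports
    "HOL-Algebra.Bij"
    "HOL-Algebra.Coset"
    "HOL-Algebra.Generated_Groups"
    "HOL-Combinatorics.Permutations"
    "HOL-Computational_Algebra.Polynomial"
    "HOL-Library.Z2"
    "HOL-Library.Function_Algebras"
    "HOL-Library.Product_Plus"
begin

section \<open>The Heisenberg superalgebra\<close>

text \<open>The constructors stand for \<open>z\<close>, \<open>e\<^sub>i\<close>, \<open>e\<^sub>i\<close> with a hat, \<open>u\<^sub>j\<close>, \<open>v\<^sub>j\<close>, \<open>z\<^sub>l\<close>. Indices start at 1 and are
  bounded by \<open>k\<close>, \<open>r\<close>, \<open>q\<close> in \<open>hbasis\<close>; an element of the superalgebra is the family of its
  coordinates, extended by zero outside \<open>hbasis k r q\<close>.\<close>

datatype hgen = Zc | Ev nat | Eh nat | Uo nat | Vo nat | Zo nat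

type_synonym 'a hvec = "hgen \<Rightarrow> 'a"

definition hbasis_even :: "nat \<Rightarrow> hgen set" where
  "hbasis_even k = {Zc} \<union> Ev ` {1..k} \<union> Eh ` {1..k}"

definition hbasis_odd :: "nat \<Rightarrow> nat \<Rightarrow> hgen set" where
  "hbasis_odd r q = Uo ` {1..r} \<union> Vo ` {1..r} \<union> Zo ` {1..q}"

definition hbasis :: "nat \<Rightarrow> nat \<Rightarrow> nat \<Rightarrow> hgen set" where
  "hbasis k r q = hbasis_even k \<union> hbasis_odd r q"

definition hspan :: "hgen set \<Rightarrow> 'a::zero hvec set" where
  "hspan B = {x. \<forall>b. b \<notin> B \<longrightarrow> x b = 0}"

abbreviation heis :: "nat \<Rightarrow> nat \<Rightarrow> nat \<Rightarrow> 'a::zero hvec set" where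
  "heis k r q \<equiv> hspan (hbasis k r q)"

definition hscale :: "'a::times \<Rightarrow> 'a hvec \<Rightarrow> 'a hvec" where
  "hscale c x = (\<lambda>b. c * x b)"

definition basis_vec :: "hgen \<Rightarrow> 'a::zero_neq_one hvec" where
  "basis_vec b = (\<lambda>c. if c = b then 1 else 0)"

text \<open>\<open>hcoef a b\<close> is the coefficient of \<open>z\<close> in the product of the basis elements \<open>a\<close> and \<open>b\<close>.\<close>

fun hcoef :: "hgen \<Rightarrow> hgen \<Rightarrow> 'a::ring_1" where
  "hcoef (Ev i) (Eh j) = (if i = j then 1 else 0)"
| "hcoef (Eh i) (Ev j) = (if i = j then - 1 else 0)"
| "hcoef (Uo i) (Vo j) = (if i = j then 1 else 0)"
| "hcoef (Vo i) (Uo j) = (if i = j then 1 else 0)"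
| "hcoef (Zo i) (Zo j) = (if i = j then 1 else 0)"
| "hcoef _ _ = 0"

definition hbracket :: "nat \<Rightarrow> nat \<Rightarrow> nat \<Rightarrow> 'a::comm_ring_1 hvec \<Rightarrow> 'a hvec \<Rightarrow> 'a hvec" where
  "hbracket k r q x y =
     (\<Sum>a\<in>hbasis k r q. \<Sum>b\<in>hbasis k r q. hscale (x a * y b * hcoef a b) (basis_vec Zc))"

text \<open>Automorphisms are extensional functions on the carrier, as in \<^const>\<open>BijGroup\<close>.\<close>

definition hlinear :: "nat \<Rightarrow> nat \<Rightarrow> nat \<Rightarrow> ('a::comm_ring_1 hvec \<Rightarrow> 'a hvec) \<Rightarrow> bool" where
  "hlinear k r q f \<longleftrightarrow>
     (\<forall>x\<in>heis k r q. \<forall>y\<in>heis k r q. f (x + y) = f x + f y) \<and>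
     (\<forall>c. \<forall>x\<in>heis k r q. f (hscale c x) = hscale c (f x))"

definition haut :: "nat \<Rightarrow> nat \<Rightarrow> nat \<Rightarrow> ('a::comm_ring_1 hvec \<Rightarrow> 'a hvec) set" where
  "haut k r q = {f \<in> Bij (heis k r q).
     hlinear k r q f \<and>
     f ` hspan (hbasis_even k) \<subseteq> hspan (hbasis_even k) \<and>
     f ` hspan (hbasis_odd r q) \<subseteq> hspan (hbasis_odd r q) \<and>
     (\<forall>x\<in>heis k r q. \<forall>y\<in>heis k r q. f (hbracket k r q x y) = hbracket k r q (f x) (f y))}"

section \<open>The grading and its Weyl group\<close>

text \<open>The subgroup \<open>\<int> \<times> \<int>\<^sup>k \<times> \<int>\<^sup>r \<times> \<int>\<^sub>2\<^sup>q\<close> consists of the elements of the following type whose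
  components are supported on \<open>{1..k}\<close>, \<open>{1..r}\<close> and \<open>{1..q}\<close>.\<close>

type_synonym hdegree = "int \<times> (nat \<Rightarrow> int) \<times> (nat \<Rightarrow> int) \<times> (nat \<Rightarrow> bit)"

definition hunit :: "nat \<Rightarrow> nat \<Rightarrow> 'b::zero_neq_one" where
  "hunit i = (\<lambda>j. if j = i then 1 else 0)"

fun hdeg :: "hgen \<Rightarrow> hdegree" where
  "hdeg Zc = (2, 0, 0, 0)"
| "hdeg (Ev i) = (1, hunit i, 0, 0)"
| "hdeg (Eh i) = (1, - hunit i, 0, 0)"
| "hdeg (Uo j) = (1, 0, hunit j, 0)"
| "hdeg (Vo j) = (1, 0, - hunit j, 0)"
| "hdeg (Zo l) = (1, 0, 0, hunit l)"

definition hcomp :: "nat \<Rightarrow> nat \<Rightarrow> nat \<Rightarrow> hdegree \<Rightarrow> 'a::zero hvec set" where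
  "hcomp k r q g = hspan {b \<in> hbasis k r q. hdeg b = g}"

definition hgrading :: "nat \<Rightarrow> nat \<Rightarrow> nat \<Rightarrow> 'a::zero hvec set set" where
  "hgrading k r q = hcomp k r q ` hdeg ` hbasis k r q"

definition hgrad_aut :: "nat \<Rightarrow> nat \<Rightarrow> nat \<Rightarrow> ('a::comm_ring_1 hvec \<Rightarrow> 'a hvec) monoid" where
  "hgrad_aut k r q = BijGroup (heis k r q)
     \<lparr>carrier := {f \<in> haut k r q. bij_betw ((`) f) (hgrading k r q) (hgrading k r q)}\<rparr>"

definition hgrad_stab :: "nat \<Rightarrow> nat \<Rightarrow> nat \<Rightarrow> ('a::comm_ring_1 hvec \<Rightarrow> 'a hvec) set" where
  "hgrad_stab k r q = {f \<in> carrier (hgrad_aut k r q). \<forall>C\<in>hgrading k r q. f ` C = C}"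

definition weyl_group :: "nat \<Rightarrow> nat \<Rightarrow> nat \<Rightarrow> ('a::comm_ring_1 hvec \<Rightarrow> 'a hvec) set monoid" where
  "weyl_group k r q = hgrad_aut k r q Mod hgrad_stab k r q"

definition weyl_class ::
  "nat \<Rightarrow> nat \<Rightarrow> nat \<Rightarrow> ('a::comm_ring_1 hvec \<Rightarrow> 'a hvec) \<Rightarrow> ('a hvec \<Rightarrow> 'a hvec) set" where
  "weyl_class k r q f = hgrad_stab k r q #>\<^bsub>hgrad_aut k r q\<^esub> f"

section \<open>The generators\<close>

text \<open>\<open>hlin k r q \<phi>\<close> is the linear map given by \<open>\<phi>\<close> on the basis.\<close>

definition hlin :: "nat \<Rightarrow> nat \<Rightarrow> nat \<Rightarrow> (hgen \<Rightarrow> 'a hvec) \<Rightarrow> 'a::comm_ring_1 hvec \<Rightarrow> 'a hvec" where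
  "hlin k r q \<phi> = (\<lambda>x\<in>heis k r q. \<Sum>b\<in>hbasis k r q. hscale (x b) (\<phi> b))"

definition sigma_tilde ::
  "nat \<Rightarrow> nat \<Rightarrow> nat \<Rightarrow> (nat \<Rightarrow> nat) \<Rightarrow> 'a::comm_ring_1 hvec \<Rightarrow> 'a hvec" where
  "sigma_tilde k r q \<sigma> = hlin k r q (\<lambda>b. case b of
     Ev i \<Rightarrow> basis_vec (Ev (\<sigma> i)) | Eh i \<Rightarrow> basis_vec (Eh (\<sigma> i)) | _ \<Rightarrow> basis_vec b)"

definition mu :: "nat \<Rightarrow> nat \<Rightarrow> nat \<Rightarrow> nat \<Rightarrow> 'a::comm_ring_1 hvec \<Rightarrow> 'a hvec" where
  "mu k r q i = hlin k r q (basis_vec (Ev i := basis_vec (Eh i), Eh i := - basis_vec (Ev i)))"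

definition sigma_bar ::
  "nat \<Rightarrow> nat \<Rightarrow> nat \<Rightarrow> (nat \<Rightarrow> nat) \<Rightarrow> 'a::comm_ring_1 hvec \<Rightarrow> 'a hvec" where
  "sigma_bar k r q \<sigma> = hlin k r q (\<lambda>b. case b of
     Uo i \<Rightarrow> basis_vec (Uo (\<sigma> i)) | Vo i \<Rightarrow> basis_vec (Vo (\<sigma> i)) | _ \<Rightarrow> basis_vec b)"

definition rho_hat ::
  "nat \<Rightarrow> nat \<Rightarrow> nat \<Rightarrow> (nat \<Rightarrow> nat) \<Rightarrow> 'a::comm_ring_1 hvec \<Rightarrow> 'a hvec" where
  "rho_hat k r q \<rho> = hlin k r q (\<lambda>b. case b of Zo l \<Rightarrow> basis_vec (Zo (\<rho> l)) | _ \<Rightarrow> basis_vec b)"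

definition mu' :: "nat \<Rightarrow> nat \<Rightarrow> nat \<Rightarrow> nat \<Rightarrow> 'a::comm_ring_1 hvec \<Rightarrow> 'a hvec" where
  "mu' k r q i = hlin k r q (basis_vec (Uo i := basis_vec (Vo i), Vo i := basis_vec (Uo i)))"

section \<open>Well-definedness\<close>

lemma card_hbasis_even: "card (hbasis_even k) = 2 * k + 1"
proof -
  have "card (Ev ` {1..k} \<union> Eh ` {1..k}) = k + k"
    by (subst card_Un_disjoint) (auto simp: card_image inj_on_def)
  moreover have "hbasis_even k = insert Zc (Ev ` {1..k} \<union> Eh ` {1..k})"
    by (auto simp: hbasis_even_def)
  ultimately show ?thesis by (simp add: card_insert_if) auto
qed

lemma card_hbasis_odd: "card (hbasis_odd r q) = 2 * r + q"
proof -
  have "card (Uo ` {1..r} \<union> Vo ` {1..r}) = r + r"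
    by (subst card_Un_disjoint) (auto simp: card_image inj_on_def)
  moreover have "card (Zo ` {1..q}) = q"
    by (simp add: card_image inj_on_def)
  ultimately show ?thesis unfolding hbasis_odd_def
    by (subst card_Un_disjoint) auto
qed

lemma hunit_simps:
  "hunit i = hunit j \<longleftrightarrow> i = j" "hunit i \<noteq> 0" "0 \<noteq> hunit i"
  by (auto simp: hunit_def fun_eq_iff split: if_splits)

lemma hunit_neq_uminus: "(hunit i :: nat \<Rightarrow> int) \<noteq> - hunit j" "- hunit j \<noteq> (hunit i :: nat \<Rightarrow> int)"
  by (auto simp: hunit_def fun_eq_iff split: if_splits intro!: exI[of _ i])

lemma hdeg_inj: "hdeg a = hdeg b \<longleftrightarrow> a = b"
  by (cases a; cases b) (simp_all add: hunit_simps hunit_neq_uminus)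

lemma hdeg_product: "hcoef a b \<noteq> (0 :: 'a::ring_1) \<Longrightarrow> hdeg Zc = hdeg a + hdeg b"
  by (induction a b rule: hcoef.induct) (auto simp: fun_eq_iff split: if_splits)

lemma hspan_singleton: "hspan {b} = range (\<lambda>c :: 'a::comm_ring_1. hscale c (basis_vec b))"
  by (auto simp: hspan_def hscale_def basis_vec_def fun_eq_iff image_iff intro!: exI)

text \<open>The homogeneous components are the lines spanned by the basis elements.\<close>

lemma hgrading_eq:
  "hgrading k r q = (\<lambda>b. range (\<lambda>c :: 'a::comm_ring_1. hscale c (basis_vec b))) ` hbasis k r q"
proof -
  have "hcomp k r q (hdeg b) = range (\<lambda>c :: 'a. hscale c (basis_vec b))" if "b \<in> hbasis k r q" for b
  proof -
    have "{b' \<in> hbasis k r q. hdeg b' = hdeg b} = {b}"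
      using that by (auto simp: hdeg_inj)
    then show ?thesis by (simp add: hcomp_def hspan_singleton)
  qed
  then show ?thesis by (auto simp: hgrading_def image_image intro!: image_cong)
qed

lemma hbasis_finite: "finite (hbasis k r q)"
  by (simp add: hbasis_def hbasis_even_def hbasis_odd_def)

lemma hspan_add: "x \<in> hspan B \<Longrightarrow> y \<in> hspan B \<Longrightarrow> x + y \<in> (hspan B :: 'a::comm_ring_1 hvec set)"
  by (simp add: hspan_def)

lemma hspan_scale: "x \<in> hspan B \<Longrightarrow> hscale c x \<in> (hspan B :: 'a::comm_ring_1 hvec set)"
  by (simp add: hspan_def hscale_def)

lemma hspan_mono: "A \<subseteq> B \<Longrightarrow> hspan A \<subseteq> hspan B"
  by (auto simp: hspan_def)

lemma hbracket_apply:
  "hbracket k r q x y c =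
    (if c = Zc then \<Sum>a\<in>hbasis k r q. \<Sum>b\<in>hbasis k r q. x a * y b * hcoef a b else 0)"
proof -
  have *: "sum F A c = (\<Sum>a\<in>A. F a c)" for F :: "hgen \<Rightarrow> 'a hvec" and A
    by (induction A rule: infinite_finite_induct) auto
  show ?thesis by (simp add: hbracket_def * hscale_def basis_vec_def)
qed

lemma hbracket_closed: "hbracket k r q x y \<in> heis k r q"
  by (auto simp: hspan_def hbracket_apply hbasis_def hbasis_even_def)

lemma haut_inv:
  assumes f: "(f :: 'a::comm_ring_1 hvec \<Rightarrow> 'a hvec) \<in> haut k r q"
  shows "(\<lambda>x\<in>heis k r q. inv_into (heis k r q) f x) \<in> haut k r q"
proof -
  let ?H = "heis k r q :: 'a hvec set" and ?E = "hspan (hbasis_even k) :: 'a hvec set"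
    and ?O = "hspan (hbasis_odd r q) :: 'a hvec set"
  define g where "g = (\<lambda>x\<in>?H. inv_into ?H f x)"
  have bij: "f \<in> Bij ?H"
    and even: "f ` ?E \<subseteq> ?E" and odd: "f ` ?O \<subseteq> ?O"
    and lin: "hlinear k r q f"
    and br: "\<And>x y. x \<in> ?H \<Longrightarrow> y \<in> ?H \<Longrightarrow> f (hbracket k r q x y) = hbracket k r q (f x) (f y)"
    using f unfolding haut_def by simp_all
  have inj: "inj_on f ?H" and im: "f ` ?H = ?H"
    using bij by (simp_all add: Bij_def bij_betw_def)
  have add: "\<And>x y. x \<in> ?H \<Longrightarrow> y \<in> ?H \<Longrightarrow> f (x + y) = f x + f y"
    and scale: "\<And>c x. x \<in> ?H \<Longrightarrow> f (hscale c x) = hscale c (f x)"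
    using lin by (simp_all add: hlinear_def)
  have g: "g (f x) = x" if x: "x \<in> ?H" for x
  proof -
    have "f x \<in> ?H" using x im by blast
    then show ?thesis using x inj by (simp add: g_def inv_into_f_f)
  qed
  have ex: "\<exists>x'\<in>?H. x = f x'" if "x \<in> ?H" for x using that im by auto
  have EH: "?E \<subseteq> ?H" and OH: "?O \<subseteq> ?H" by (intro hspan_mono; simp add: hbasis_def)+
  have EO0: "x = 0" if "x \<in> ?E" "x \<in> ?O" for x
  proof
    fix b show "x b = 0 b" using that by (cases b) (auto simp: hspan_def hbasis_even_def hbasis_odd_def)
  qed
  have zero: "0 \<in> ?H" by (simp add: hspan_def)
  have f0: "f 0 = 0" using add[OF zero zero] by simp
  have split: "\<exists>a\<in>?E. \<exists>b\<in>?O. x = a + b" if x: "x \<in> ?H" for x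
  proof -
    have "x = (\<lambda>b. if b \<in> hbasis_even k then x b else 0) + (\<lambda>b. if b \<in> hbasis_even k then 0 else x b)"
      by auto
    moreover have "(\<lambda>b. if b \<in> hbasis_even k then x b else 0) \<in> ?E" by (simp add: hspan_def)
    moreover have "(\<lambda>b. if b \<in> hbasis_even k then 0 else x b) \<in> ?O"
      using x by (auto simp: hspan_def hbasis_def)
    ultimately show ?thesis by blast
  qed
  have minus: "x - y \<in> hspan B" if "x \<in> hspan B" "y \<in> hspan B" for x y :: "'a hvec" and B
    using that by (simp add: hspan_def)
  have gE: "g ` ?E \<subseteq> ?E"
  proof (rule image_subsetI)
    fix y assume y: "y \<in> ?E"
    then have "y \<in> ?H" using EH by (rule subsetD[rotated])
    then obtain x where x: "x \<in> ?H" "y = f x" using ex by blast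
    obtain a b where ab: "a \<in> ?E" "b \<in> ?O" "x = a + b" using split[OF x(1)] by blast
    have abH: "a \<in> ?H" "b \<in> ?H" using ab(1,2) EH OH by (simp_all add: subsetD)
    have "y = f a + f b" unfolding x(2) ab(3) by (rule add[OF abH])
    then have *: "f b = y - f a" by simp
    have "f a \<in> ?E" using even ab by (simp add: image_subset_iff)
    then have 1: "f b \<in> ?E" unfolding * by (rule minus[OF y])
    have 2: "f b \<in> ?O" using odd ab by (simp add: image_subset_iff)
    have "f b = 0" by (rule EO0) (fact 1 2)+
    then have "b = 0" using inj_onD[OF inj, of b 0] zero abH f0 by simp
    then show "g y \<in> ?E" using x ab g by simp
  qed
  have gO: "g ` ?O \<subseteq> ?O"
  proof (rule image_subsetI)
    fix y assume y: "y \<in> ?O"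
    then have "y \<in> ?H" using OH by (rule subsetD[rotated])
    then obtain x where x: "x \<in> ?H" "y = f x" using ex by blast
    obtain a b where ab: "a \<in> ?E" "b \<in> ?O" "x = a + b" using split[OF x(1)] by blast
    have abH: "a \<in> ?H" "b \<in> ?H" using ab(1,2) EH OH by (simp_all add: subsetD)
    have "y = f a + f b" unfolding x(2) ab(3) by (rule add[OF abH])
    then have *: "f a = y - f b" by simp
    have "f b \<in> ?O" using odd ab by (simp add: image_subset_iff)
    then have 1: "f a \<in> ?O" unfolding * by (rule minus[OF y])
    have 2: "f a \<in> ?E" using even ab by (simp add: image_subset_iff)
    have "f a = 0" by (rule EO0) (fact 1 2)+
    then have "a = 0" using inj_onD[OF inj, of a 0] zero abH f0 by simp
    then show "g y \<in> ?O" using x ab g by simp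
  qed
  have gadd: "g (x + y) = g x + g y" if "x \<in> ?H" "y \<in> ?H" for x y
  proof -
    obtain x' where x: "x' \<in> ?H" "x = f x'" using ex[OF \<open>x \<in> ?H\<close>] by blast
    obtain y' where y: "y' \<in> ?H" "y = f y'" using ex[OF \<open>y \<in> ?H\<close>] by blast
    note xy = x y
    then have "x + y = f (x' + y')" using add by simp
    then show ?thesis using xy by (simp add: g hspan_add)
  qed
  have gscale: "g (hscale c x) = hscale c (g x)" if "x \<in> ?H" for c x
  proof -
    obtain x' where x: "x' \<in> ?H" "x = f x'" using ex[OF \<open>x \<in> ?H\<close>] by blast
    then have "hscale c x = f (hscale c x')" using scale by simp
    then show ?thesis using x by (simp add: g hspan_scale)
  qed
  have gbr: "g (hbracket k r q x y) = hbracket k r q (g x) (g y)" if "x \<in> ?H" "y \<in> ?H" for x y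
  proof -
    obtain x' where x: "x' \<in> ?H" "x = f x'" using ex[OF \<open>x \<in> ?H\<close>] by blast
    obtain y' where y: "y' \<in> ?H" "y = f y'" using ex[OF \<open>y \<in> ?H\<close>] by blast
    note xy = x y
    then have "hbracket k r q x y = f (hbracket k r q x' y')" using br by simp
    then show ?thesis using xy by (simp add: g hbracket_closed)
  qed
  have "g \<in> Bij ?H" unfolding g_def by (rule restrict_inv_into_Bij[OF bij])
  then have "g \<in> haut k r q"
    unfolding haut_def hlinear_def using gE gO gadd gscale gbr by simp
  then show ?thesis by (simp add: g_def)
qed

lemma hgrading_subset: "C \<in> hgrading k r q \<Longrightarrow> C \<subseteq> heis k r q"
  by (auto simp: hgrading_def hcomp_def hspan_def)

lemma subgroup_hgrad_aut:
  "subgroup (carrier (hgrad_aut k r q)) (BijGroup (heis k r q :: 'a::comm_ring_1 hvec set))"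
proof -
  let ?H = "heis k r q :: 'a hvec set" and ?G = "hgrading k r q :: 'a hvec set set"
  let ?A = "{f \<in> haut k r q. bij_betw ((`) f) ?G ?G}"
  have "subgroup ?A (BijGroup ?H)"
  proof (rule group.subgroupI[OF group_BijGroup])
    show "?A \<subseteq> carrier (BijGroup ?H)" by (auto simp: haut_def BijGroup_def)
    have "hspan (hbasis_even k) \<subseteq> ?H" "hspan (hbasis_odd r q) \<subseteq> ?H"
      by (intro hspan_mono; simp add: hbasis_def)+
    then have "(\<lambda>x\<in>?H. x) \<in> haut k r q"
      by (auto simp: haut_def hlinear_def id_Bij hspan_add hspan_scale hbracket_closed)
    moreover have "(`) (\<lambda>x\<in>?H. x) C = C" if "C \<in> ?G" for C
      using hgrading_subset[OF that] by force
    then have "bij_betw ((`) (\<lambda>x\<in>?H. x)) ?G ?G"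
      by (subst bij_betw_cong[where g = id]) auto
    ultimately show "?A \<noteq> {}" by blast
  next
    fix f assume f: "f \<in> ?A"
    let ?g = "\<lambda>x\<in>?H. inv_into ?H f x"
    have bij: "f \<in> Bij ?H" using f by (auto simp: haut_def)
    then have inj: "inj_on f ?H" by (simp add: Bij_def bij_betw_def)
    have gf: "?g ` (f ` C) = C" if "C \<in> ?G" for C
    proof -
      have *: "?g (f x) = x" if "x \<in> C" for x
      proof -
        have "x \<in> ?H" using that hgrading_subset \<open>C \<in> ?G\<close> by blast
        moreover from this have "f x \<in> ?H" using bij Bij_imp_funcset by blast
        ultimately show ?thesis using inj by (simp add: inv_into_f_f)
      qed
      have "(\<lambda>x. ?g (f x)) ` C = (\<lambda>x. x) ` C" by (rule image_cong[OF refl]) (rule *)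
      then show ?thesis by (simp only: image_image image_ident)
    qed
    have fim: "(`) f ` ?G = ?G" using f by (simp add: bij_betw_def)
    have "bij_betw ((`) ?g) ?G ?G"
    proof (rule bij_betw_byWitness[where f' = "(`) f"])
      show "\<forall>D\<in>?G. f ` (?g ` D) = D"
      proof
        fix D assume "D \<in> ?G"
        then obtain C where "C \<in> ?G" "D = f ` C" using fim by (metis imageE)
        then show "f ` (?g ` D) = D" using gf by metis
      qed
      show "\<forall>C\<in>?G. ?g ` (f ` C) = C" using gf by blast
      show "(`) ?g ` ?G \<subseteq> ?G"
      proof clarify
        fix D assume "D \<in> ?G"
        then obtain C where "C \<in> ?G" "D = f ` C" using fim by (metis imageE)
        then show "?g ` D \<in> ?G" using gf by metis
      qed
      show "(`) f ` ?G \<subseteq> ?G" using fim by simp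
    qed
    then show "inv\<^bsub>BijGroup ?H\<^esub> f \<in> ?A"
      using haut_inv f bij by (auto simp: inv_BijGroup)
  next
    fix f g assume f: "f \<in> ?A" and g: "g \<in> ?A"
    have fB: "f \<in> Bij ?H" and gB: "g \<in> Bij ?H" using f g by (auto simp: haut_def)
    have gH: "g x \<in> ?H" if "x \<in> ?H" for x using gB that Bij_imp_funcset by blast
    have EH: "hspan (hbasis_even k) \<subseteq> ?H" and OH: "hspan (hbasis_odd r q) \<subseteq> ?H"
      by (intro hspan_mono; simp add: hbasis_def)+
    have "compose ?H f g \<in> haut k r q"
      unfolding haut_def mem_Collect_eq
    proof (intro conjI)
      show "compose ?H f g \<in> Bij ?H" by (rule compose_Bij[OF fB gB])
      show "hlinear k r q (compose ?H f g)"
        using f g gH by (auto simp: haut_def hlinear_def compose_def hspan_add hspan_scale)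
      show "compose ?H f g ` hspan (hbasis_even k) \<subseteq> hspan (hbasis_even k)"
        using f g EH by (force simp: haut_def compose_def)
      show "compose ?H f g ` hspan (hbasis_odd r q) \<subseteq> hspan (hbasis_odd r q)"
        using f g OH by (force simp: haut_def compose_def)
      show "\<forall>x\<in>?H. \<forall>y\<in>?H. compose ?H f g (hbracket k r q x y)
          = hbracket k r q (compose ?H f g x) (compose ?H f g y)"
        using f g gH by (auto simp: haut_def compose_def hbracket_closed)
    qed
    moreover have "bij_betw ((`) (compose ?H f g)) ?G ?G"
    proof -
      have "compose ?H f g ` C = f ` (g ` C)" if "C \<in> ?G" for C
        using hgrading_subset[OF that] by (force simp: compose_def)
      moreover have "bij_betw ((`) f \<circ> (`) g) ?G ?G" using f g by (auto intro: bij_betw_trans)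
      ultimately show ?thesis by (subst bij_betw_cong[where g = "(`) f \<circ> (`) g"]) auto
    qed
    ultimately show "f \<otimes>\<^bsub>BijGroup ?H\<^esub> g \<in> ?A"
      using fB gB by (simp add: BijGroup_def)
  qed
  then show ?thesis by (simp add: hgrad_aut_def)
qed

lemma group_hgrad_aut: "group (hgrad_aut k r q)"
proof -
  have "hgrad_aut k r q = BijGroup (heis k r q) \<lparr>carrier := carrier (hgrad_aut k r q)\<rparr>"
    by (simp add: hgrad_aut_def)
  then show ?thesis
    using subgroup.subgroup_is_group[OF subgroup_hgrad_aut group_BijGroup] by metis
qed

lemma hgrad_aut_mult_image:
  assumes "f \<in> carrier (hgrad_aut k r q)" "g \<in> carrier (hgrad_aut k r q)"
    and "C \<in> hgrading k r q"
  shows "(f \<otimes>\<^bsub>hgrad_aut k r q\<^esub> g) ` C = f ` (g ` C)"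
  using assms hgrading_subset[of C k r q]
  by (force simp: hgrad_aut_def BijGroup_def haut_def compose_def)

lemma normal_hgrad_stab:
  "hgrad_stab k r q \<lhd> (hgrad_aut k r q :: ('a::comm_ring_1 hvec \<Rightarrow> 'a hvec) monoid)"
proof -
  let ?A = "hgrad_aut k r q :: ('a hvec \<Rightarrow> 'a hvec) monoid"
    and ?S = "hgrad_stab k r q :: ('a hvec \<Rightarrow> 'a hvec) set"
    and ?G = "hgrading k r q :: 'a hvec set set"
  interpret A: group ?A by (rule group_hgrad_aut)
  have one: "\<one>\<^bsub>?A\<^esub> ` C = C" if "C \<in> ?G" for C
    using hgrading_subset[OF that] by (force simp: hgrad_aut_def BijGroup_def)
  have inG: "f ` C \<in> ?G" if "f \<in> carrier ?A" "C \<in> ?G" for f C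
    using that by (auto simp: hgrad_aut_def bij_betw_def)
  have inv1: "(inv\<^bsub>?A\<^esub> f) ` (f ` C) = C" if "f \<in> carrier ?A" "C \<in> ?G" for f C
    using hgrad_aut_mult_image[of "inv\<^bsub>?A\<^esub> f" k r q f C] that one by simp
  have inv2: "f ` ((inv\<^bsub>?A\<^esub> f) ` C) = C" if "f \<in> carrier ?A" "C \<in> ?G" for f C
    using hgrad_aut_mult_image[of f k r q "inv\<^bsub>?A\<^esub> f" C] that one by simp
  have "subgroup ?S ?A"
  proof (rule A.subgroupI)
    show "?S \<subseteq> carrier ?A" by (auto simp: hgrad_stab_def)
    show "?S \<noteq> {}" using one by (auto simp: hgrad_stab_def)
  next
    fix f assume f: "f \<in> ?S"
    then show "inv\<^bsub>?A\<^esub> f \<in> ?S" using inv1 by (auto simp: hgrad_stab_def) force+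
  next
    fix f g assume "f \<in> ?S" "g \<in> ?S"
    then show "f \<otimes>\<^bsub>?A\<^esub> g \<in> ?S"
      by (simp add: hgrad_stab_def hgrad_aut_mult_image)
  qed
  moreover have "f \<otimes>\<^bsub>?A\<^esub> h \<otimes>\<^bsub>?A\<^esub> inv\<^bsub>?A\<^esub> f \<in> ?S" if f: "f \<in> carrier ?A" and h: "h \<in> ?S" for f h
  proof -
    have hA: "h \<in> carrier ?A" using h by (simp add: hgrad_stab_def)
    have "(f \<otimes>\<^bsub>?A\<^esub> h \<otimes>\<^bsub>?A\<^esub> inv\<^bsub>?A\<^esub> f) ` C = C" if C: "C \<in> ?G" for C
    proof -
      have D: "(inv\<^bsub>?A\<^esub> f) ` C \<in> ?G" using inG f C by simp
      then have "h ` (inv\<^bsub>?A\<^esub> f) ` C = (inv\<^bsub>?A\<^esub> f) ` C" using h by (simp add: hgrad_stab_def)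
      then show ?thesis using f hA C D inv2 by (simp add: hgrad_aut_mult_image)
    qed
    then show ?thesis using f hA by (simp add: hgrad_stab_def)
  qed
  ultimately show ?thesis by (simp add: A.normal_inv_iff)
qed

text \<open>The maps above belong to \<open>Aut \<Gamma>\<^sup>r\<close>.\<close>

lemma hlin_apply: "x \<in> heis k r q \<Longrightarrow> hlin k r q \<phi> x c = (\<Sum>b\<in>hbasis k r q. x b * \<phi> b c)"
proof -
  have *: "sum F A c = (\<Sum>a\<in>A. F a c)" for F :: "hgen \<Rightarrow> 'a hvec" and A
    by (induction A rule: infinite_finite_induct) auto
  show "x \<in> heis k r q \<Longrightarrow> ?thesis" by (simp add: hlin_def * hscale_def)
qed

lemma hlin_monomial:
  fixes \<phi> :: "hgen \<Rightarrow> 'a::comm_ring_1 hvec"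
  assumes \<phi>: "\<And>b. b \<in> hbasis k r q \<Longrightarrow> \<phi> b = hscale (s b) (basis_vec (p b))"
    and inj: "inj_on p (hbasis k r q)"
    and even: "p ` hbasis_even k \<subseteq> hbasis_even k" and odd: "p ` hbasis_odd r q \<subseteq> hbasis_odd r q"
    and pZ: "p Zc = Zc" and sZ: "s Zc = 1"
    and s: "\<And>b. s b * s b = 1"
    and coef: "\<And>a b. a \<in> hbasis k r q \<Longrightarrow> b \<in> hbasis k r q \<Longrightarrow>
      s a * s b * hcoef (p a) (p b) = hcoef a b"
  shows "hlin k r q \<phi> \<in> carrier (hgrad_aut k r q)"
proof -
  let ?B = "hbasis k r q" and ?H = "heis k r q :: 'a hvec set" and ?f = "hlin k r q \<phi>"
  have fin: "finite ?B" by (rule hbasis_finite)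
  have pB: "p ` ?B \<subseteq> ?B" using even odd by (auto simp: hbasis_def)
  have pim: "p ` ?B = ?B" by (rule endo_inj_surj[OF fin pB inj])
  have ZB: "Zc \<in> ?B" by (simp add: hbasis_def hbasis_even_def)
  have f1: "?f x (p b) = s b * x b" if x: "x \<in> ?H" and b: "b \<in> ?B" for x b
  proof -
    have "?f x (p b) = (\<Sum>a\<in>?B. if a = b then s b * x b else 0)"
      unfolding hlin_apply[OF x]
      using inj b by (intro sum.cong refl) (auto simp: \<phi> hscale_def basis_vec_def inj_on_eq_iff)
    then show ?thesis using fin b by simp
  qed
  have f0: "?f x c = 0" if x: "x \<in> ?H" and c: "c \<notin> ?B" for x c
    unfolding hlin_apply[OF x]
    using pB c by (intro sum.neutral ballI) (auto simp: \<phi> hscale_def basis_vec_def)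
  have eqI: "x = y" if "\<And>b. b \<in> ?B \<Longrightarrow> x (p b) = y (p b)" "\<And>c. c \<notin> ?B \<Longrightarrow> x c = y c"
    for x y :: "'a hvec"
  proof
    fix c show "x c = y c"
    proof (cases "c \<in> ?B")
      case True
      then obtain b where "b \<in> ?B" "c = p b" using pim by blast
      then show ?thesis using that(1) by simp
    qed (rule that(2))
  qed
  have fH: "?f x \<in> ?H" if "x \<in> ?H" for x
    using f0[OF that] by (simp add: hspan_def)
  have H0: "x c = 0" if "x \<in> ?H" "c \<notin> ?B" for x c using that by (simp add: hspan_def)
  have finj: "inj_on ?f ?H"
  proof (rule inj_onI)
    fix x y assume x: "x \<in> ?H" and y: "y \<in> ?H" and xy: "?f x = ?f y"
    show "x = y"
    proof
      fix b show "x b = y b"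
      proof (cases "b \<in> ?B")
        case True
        then have "s b * x b = s b * y b" using f1[OF x] f1[OF y] xy by metis
        then have "(s b * s b) * x b = (s b * s b) * y b" by (simp only: mult.assoc)
        then show ?thesis by (simp add: s)
      qed (simp add: H0[OF x] H0[OF y])
    qed
  qed
  have fsurj: "?f ` ?H = ?H"
  proof
    show "?f ` ?H \<subseteq> ?H" using fH by blast
    show "?H \<subseteq> ?f ` ?H"
    proof
      fix y assume y: "y \<in> ?H"
      define x where "x = (\<lambda>b. if b \<in> ?B then s b * y (p b) else 0)"
      have x: "x \<in> ?H" by (simp add: x_def hspan_def)
      have "?f x = y"
      proof (rule eqI)
        fix b assume b: "b \<in> ?B"
        then show "?f x (p b) = y (p b)"
          by (simp add: f1[OF x b]) (simp add: x_def s flip: mult.assoc)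
      qed (simp add: f0[OF x] H0[OF y])
      then show "y \<in> ?f ` ?H" using x by blast
    qed
  qed
  have Bij: "?f \<in> Bij ?H"
    using finj fsurj by (simp add: Bij_def bij_betw_def hlin_def)
  have lin: "hlinear k r q ?f"
    unfolding hlinear_def
  proof (intro conjI ballI allI)
    fix x y assume "x \<in> ?H" "y \<in> ?H"
    then show "?f (x + y) = ?f x + ?f y"
      by (intro eqI) (simp_all add: f1 f0 hspan_add distrib_left)
  next
    fix c x assume x: "x \<in> ?H"
    have cx: "hscale c x \<in> ?H" by (rule hspan_scale[OF x])
    show "?f (hscale c x) = hscale c (?f x)"
      by (rule eqI) (simp_all add: f1 f0 cx x, simp_all add: hscale_def f1 f0 x mult.left_commute)
  qed
  have par: "?f ` hspan D \<subseteq> hspan D" if D: "D \<subseteq> ?B" "p ` D \<subseteq> D" for D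
  proof clarify
    fix x :: "'a hvec" assume x: "x \<in> hspan D"
    then have xH: "x \<in> ?H" using hspan_mono D(1) by blast
    have "?f x c = 0" if c: "c \<notin> D" for c
    proof (cases "c \<in> ?B")
      case True
      then obtain b where b: "b \<in> ?B" "c = p b" using pim by blast
      then have "b \<notin> D" using D(2) c by blast
      then have "x b = 0" using x by (simp add: hspan_def)
      then show ?thesis using b f1[OF xH] by simp
    qed (rule f0[OF xH])
    then show "?f x \<in> hspan D" by (simp add: hspan_def)
  qed
  have reindex: "sum g ?B = (\<Sum>a\<in>?B. g (p a))" for g :: "hgen \<Rightarrow> 'a"
    using sum.reindex[OF inj, of g] unfolding pim by (simp add: o_def)
  have br: "?f (hbracket k r q x y) = hbracket k r q (?f x) (?f y)" if x: "x \<in> ?H" and y: "y \<in> ?H" for x y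
  proof (rule eqI)
    fix b assume b: "b \<in> ?B"
    have 1: "?f (hbracket k r q x y) (p b) = s b * hbracket k r q x y b"
      by (rule f1[OF hbracket_closed b])
    show "?f (hbracket k r q x y) (p b) = hbracket k r q (?f x) (?f y) (p b)"
    proof (cases "b = Zc")
      case False
      then have "p b \<noteq> Zc" using inj b ZB pZ by (metis inj_onD)
      then show ?thesis using False 1 by (simp add: hbracket_apply)
    next
      case True
      have "(\<Sum>a\<in>?B. \<Sum>c\<in>?B. ?f x a * ?f y c * hcoef a c)
          = (\<Sum>a\<in>?B. \<Sum>c\<in>?B. ?f x (p a) * ?f y c * hcoef (p a) c)"
        by (rule reindex)
      also have "\<dots> = (\<Sum>a\<in>?B. \<Sum>c\<in>?B. ?f x (p a) * ?f y (p c) * hcoef (p a) (p c))"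
        by (rule sum.cong[OF refl]) (rule reindex)
      also have "\<dots> = (\<Sum>a\<in>?B. \<Sum>c\<in>?B. x a * y c * hcoef a c)"
      proof (intro sum.cong refl)
        fix a c assume ac: "a \<in> ?B" "c \<in> ?B"
        have "?f x (p a) * ?f y (p c) * hcoef (p a) (p c)
            = x a * y c * (s a * s c * hcoef (p a) (p c))"
          using f1[OF x ac(1)] f1[OF y ac(2)] by (simp add: mult_ac)
        then show "?f x (p a) * ?f y (p c) * hcoef (p a) (p c) = x a * y c * hcoef a c"
          using coef[OF ac] by simp
      qed
      finally show ?thesis using 1 True pZ sZ by (simp add: hbracket_apply)
    qed
  next
    fix c assume c: "c \<notin> ?B"
    show "?f (hbracket k r q x y) c = hbracket k r q (?f x) (?f y) c"
      using f0[OF hbracket_closed c] H0[OF hbracket_closed c] by simp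
  qed
  have "?f \<in> haut k r q"
    unfolding haut_def using Bij lin br even odd by (simp add: par hbasis_def)
  moreover have "bij_betw ((`) ?f) (hgrading k r q) (hgrading k r q)"
  proof -
    let ?G = "hgrading k r q :: 'a hvec set set"
    have "finite ?G" using fin by (simp add: hgrading_def)
    moreover have "inj_on ((`) ?f) ?G"
      using finj by (intro inj_onI) (metis hgrading_subset inj_on_image_eq_iff)
    moreover have "?f ` C \<in> ?G" if "C \<in> ?G" for C
    proof -
      obtain b where b: "b \<in> ?B" and C: "C = range (\<lambda>c. hscale c (basis_vec b))"
        using \<open>C \<in> ?G\<close> unfolding hgrading_eq by (rule imageE) blast
      have val: "?f (hscale c (basis_vec b)) = hscale (c * s b) (basis_vec (p b))" for c
      proof -
        have H: "hscale c (basis_vec b) \<in> ?H" using b by (auto simp: hspan_def hscale_def basis_vec_def)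
        show ?thesis
          using b pB inj
          by (intro eqI) (auto simp: f1[OF H] f0[OF H], auto simp: hscale_def basis_vec_def inj_on_eq_iff)
      qed
      have "?f ` C = range (\<lambda>c. hscale c (basis_vec (p b)))"
      proof
        show "?f ` C \<subseteq> range (\<lambda>c. hscale c (basis_vec (p b)))" by (auto simp: C val)
        have "hscale c (basis_vec (p b)) = ?f (hscale (c * s b) (basis_vec b))" for c
          by (simp add: val s mult.assoc)
        then show "range (\<lambda>c. hscale c (basis_vec (p b))) \<subseteq> ?f ` C" unfolding C by blast
      qed
      then show ?thesis using b pB unfolding hgrading_eq by blast
    qed
    ultimately show ?thesis by (simp add: bij_betw_def endo_inj_surj image_subsetI)
  qed
  ultimately show ?thesis by (simp add: hgrad_aut_def)
qed

lemma basis_vec_scale1: "hscale 1 (basis_vec b) = (basis_vec b :: 'a::comm_ring_1 hvec)"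
  by (simp add: hscale_def)

lemma basis_vec_scale_neg1: "hscale (- 1) (basis_vec b) = (- basis_vec b :: 'a::comm_ring_1 hvec)"
  by (simp add: hscale_def fun_eq_iff)

lemma sigma_tilde_in_aut:
  assumes "\<sigma> permutes {1..k}"
  shows "sigma_tilde k r q \<sigma> \<in> carrier (hgrad_aut k r q)"
proof -
  have bounds: "Suc 0 \<le> \<sigma> i" "\<sigma> i \<le> k" if "Suc 0 \<le> i" "i \<le> k" for i
    using permutes_in_image[OF assms, of i] that by auto
  have eq: "\<sigma> i = \<sigma> j \<longleftrightarrow> i = j" for i j
    using permutes_inj[OF assms] by (rule inj_eq)
  show ?thesis unfolding sigma_tilde_def
    by (rule hlin_monomial[where s = "\<lambda>_. 1" and
          p = "\<lambda>b. case b of Ev i \<Rightarrow> Ev (\<sigma> i) | Eh i \<Rightarrow> Eh (\<sigma> i) | _ \<Rightarrow> b"])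
      (auto simp: basis_vec_scale1 hbasis_def hbasis_even_def hbasis_odd_def inj_on_def eq bounds
        split: hgen.splits)
qed

lemma sigma_bar_in_aut:
  assumes "\<sigma> permutes {1..r}"
  shows "sigma_bar k r q \<sigma> \<in> carrier (hgrad_aut k r q)"
proof -
  have bounds: "Suc 0 \<le> \<sigma> i" "\<sigma> i \<le> r" if "Suc 0 \<le> i" "i \<le> r" for i
    using permutes_in_image[OF assms, of i] that by auto
  have eq: "\<sigma> i = \<sigma> j \<longleftrightarrow> i = j" for i j
    using permutes_inj[OF assms] by (rule inj_eq)
  show ?thesis unfolding sigma_bar_def
    by (rule hlin_monomial[where s = "\<lambda>_. 1" and
          p = "\<lambda>b. case b of Uo i \<Rightarrow> Uo (\<sigma> i) | Vo i \<Rightarrow> Vo (\<sigma> i) | _ \<Rightarrow> b"])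
      (auto simp: basis_vec_scale1 hbasis_def hbasis_even_def hbasis_odd_def inj_on_def eq bounds
        split: hgen.splits)
qed

lemma rho_hat_in_aut:
  assumes "\<rho> permutes {1..q}"
  shows "rho_hat k r q \<rho> \<in> carrier (hgrad_aut k r q)"
proof -
  have bounds: "Suc 0 \<le> \<rho> i" "\<rho> i \<le> q" if "Suc 0 \<le> i" "i \<le> q" for i
    using permutes_in_image[OF assms, of i] that by auto
  have eq: "\<rho> i = \<rho> j \<longleftrightarrow> i = j" for i j
    using permutes_inj[OF assms] by (rule inj_eq)
  show ?thesis unfolding rho_hat_def
    by (rule hlin_monomial[where s = "\<lambda>_. 1" and p = "\<lambda>b. case b of Zo l \<Rightarrow> Zo (\<rho> l) | _ \<Rightarrow> b"])
      (auto simp: basis_vec_scale1 hbasis_def hbasis_even_def hbasis_odd_def inj_on_def eq bounds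
        split: hgen.splits)
qed

lemma mu_in_aut:
  assumes "i \<in> {1..k}"
  shows "mu k r q i \<in> carrier (hgrad_aut k r q)"
  unfolding mu_def
  by (rule hlin_monomial[where s = "(\<lambda>_. 1)(Eh i := - 1)" and p = "id(Ev i := Eh i, Eh i := Ev i)"])
    (use assms in \<open>auto simp: basis_vec_scale1 basis_vec_scale_neg1 hbasis_def hbasis_even_def
      hbasis_odd_def inj_on_def split: if_splits\<close>)

lemma mu'_in_aut:
  assumes "i \<in> {1..r}"
  shows "mu' k r q i \<in> carrier (hgrad_aut k r q)"
  unfolding mu'_def
  by (rule hlin_monomial[where s = "\<lambda>_. 1" and p = "id(Uo i := Vo i, Vo i := Uo i)"])
    (use assms in \<open>auto simp: basis_vec_scale1 hbasis_def hbasis_even_def hbasis_odd_def inj_on_def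
      split: if_splits\<close>)

end

theory Submission
  imports Defs
begin

text \<open>An automorphism of \<open>\<Gamma>\<^sup>r\<close> permutes the lines spanned by the basis elements, and its class in the
  Weyl group is determined by the resulting permutation \<open>p\<close> of the basis (\<open>weyl_class_eqI\<close>). The
  Weyl group is therefore known once it is known which \<open>p\<close> occur.

  The product of basis elements \<open>a\<close>, \<open>b\<close> is a nonzero multiple of \<open>z\<close> exactly if \<open>b\<close> is the partner
  of \<open>a\<close> (\<open>e\<^sub>i\<close> and its hat, \<open>u\<^sub>j\<close> and \<open>v\<^sub>j\<close>, \<open>z\<^sub>l\<close> and itself). An automorphism maps products to
  products, so \<open>p\<close> fixes \<open>z\<close> and commutes with taking partners; it also preserves parity
  (\<open>acts_as_obtain\<close>). Hence \<open>p\<close> permutes the even pairs among themselves, the odd pairs among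
  themselves (an odd pair cannot go to a self-paired \<open>z\<^sub>l\<close>), and the \<open>z\<^sub>l\<close> among themselves.

  Exchanging the two members of suitable pairs makes \<open>p\<close> respect the distinction between \<open>e\<^sub>i\<close> and
  its hat and between \<open>u\<^sub>j\<close> and \<open>v\<^sub>j\<close>; what is left is a permutation of the three sets of indices.
  The exchange in the \<open>i\<close>-th pair is conjugate to the exchange in the first one under a permutation
  of indices. So all possible \<open>p\<close> are products of those induced by \<open>\<mu>\<^sub>1\<close>, \<open>\<mu>'\<^sub>1\<close> and the index
  permutations (\<open>pairing_symmetry_generated\<close>), which gives the theorem.\<close>

section \<open>Symmetries of the pairing on the basis\<close>

text \<open>The central element pairs with nothing. Letting it be its own partner makes \<open>partner\<close> an
  involution, and a map that fixes \<open>Zc\<close> then commutes with \<open>partner\<close> at \<open>Zc\<close> for free.\<close>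

fun partner :: "hgen \<Rightarrow> hgen" where
  "partner Zc = Zc"
| "partner (Ev i) = Eh i"
| "partner (Eh i) = Ev i"
| "partner (Uo j) = Vo j"
| "partner (Vo j) = Uo j"
| "partner (Zo l) = Zo l"

definition pairing_symmetry :: "nat \<Rightarrow> nat \<Rightarrow> nat \<Rightarrow> (hgen \<Rightarrow> hgen) \<Rightarrow> bool" where
  "pairing_symmetry k r q p \<longleftrightarrow>
     inj_on p (hbasis k r q) \<and> p Zc = Zc \<and>
     p ` hbasis_even k \<subseteq> hbasis_even k \<and> p ` hbasis_odd r q \<subseteq> hbasis_odd r q \<and>
     (\<forall>b\<in>hbasis k r q. p (partner b) = partner (p b))"

fun relabel :: "(nat \<Rightarrow> nat) \<Rightarrow> (nat \<Rightarrow> nat) \<Rightarrow> (nat \<Rightarrow> nat) \<Rightarrow> hgen \<Rightarrow> hgen" where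
  "relabel \<sigma> \<tau> \<rho> Zc = Zc"
| "relabel \<sigma> \<tau> \<rho> (Ev i) = Ev (\<sigma> i)"
| "relabel \<sigma> \<tau> \<rho> (Eh i) = Eh (\<sigma> i)"
| "relabel \<sigma> \<tau> \<rho> (Uo j) = Uo (\<tau> j)"
| "relabel \<sigma> \<tau> \<rho> (Vo j) = Vo (\<tau> j)"
| "relabel \<sigma> \<tau> \<rho> (Zo l) = Zo (\<rho> l)"

abbreviation flip :: "hgen \<Rightarrow> hgen \<Rightarrow> hgen" where
  "flip b \<equiv> Transposition.transpose b (partner b)"

lemma partner_partner [simp]: "partner (partner b) = b"
  by (cases b) auto

lemma partner_in_hbasis [simp]: "partner b \<in> hbasis k r q \<longleftrightarrow> b \<in> hbasis k r q"
  by (cases b) (auto simp: hbasis_def hbasis_even_def hbasis_odd_def)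

lemma partner_in_hbasis_even [simp]: "partner b \<in> hbasis_even k \<longleftrightarrow> b \<in> hbasis_even k"
  by (cases b) (auto simp: hbasis_even_def)

lemma partner_in_hbasis_odd [simp]: "partner b \<in> hbasis_odd r q \<longleftrightarrow> b \<in> hbasis_odd r q"
  by (cases b) (auto simp: hbasis_odd_def)

lemma Zc_in_hbasis [simp]: "Zc \<in> hbasis k r q"
  by (simp add: hbasis_def hbasis_even_def)

lemma hcoef_nonzero_iff:
  "hcoef a b \<noteq> (0 :: 'a::ring_1) \<longleftrightarrow> a \<noteq> Zc \<and> b = partner a"
  by (cases a; cases b) auto

lemma flip_partner: "flip b (partner c) = partner (flip b c)"
  by (metis partner_partner transpose_apply_first transpose_apply_other transpose_apply_second)

lemma flip_mem_iff:
  assumes "partner b \<in> A \<longleftrightarrow> b \<in> A"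
  shows "flip b c \<in> A \<longleftrightarrow> c \<in> A"
  using assms by (auto simp: Transposition.transpose_def)

lemma pairing_symmetry_flip:
  assumes p: "pairing_symmetry k r q p" and b: "b \<noteq> Zc"
  shows "pairing_symmetry k r q (p \<circ> flip b)"
proof -
  have mem: "flip b c \<in> hbasis_even k \<longleftrightarrow> c \<in> hbasis_even k"
      "flip b c \<in> hbasis_odd r q \<longleftrightarrow> c \<in> hbasis_odd r q"
      "flip b c \<in> hbasis k r q \<longleftrightarrow> c \<in> hbasis k r q" for c
    by (rule flip_mem_iff, simp)+
  have "flip b ` hbasis k r q \<subseteq> hbasis k r q"
    by (simp only: image_subset_iff mem) simp
  then have "inj_on p (flip b ` hbasis k r q)"
    using p unfolding pairing_symmetry_def by (blast intro: inj_on_subset)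
  then have "inj_on (p \<circ> flip b) (hbasis k r q)"
    by (intro comp_inj_on inj_on_transpose)
  moreover have "flip b Zc = Zc"
    using b by (metis partner.simps(1) partner_partner transpose_apply_other)
  ultimately show ?thesis
    using p by (simp add: pairing_symmetry_def flip_partner image_subset_iff mem)
qed

text \<open>A pairing symmetry preserves the family of the \<open>e\<^sub>i\<close> and their hats because it preserves parity and fixes \<open>z\<close>. It
  separates \<open>u, v\<close> from the odd \<open>z\<^sub>l\<close> because only the latter are their own partners.\<close>

lemma pairing_symmetry_families:
  assumes p: "pairing_symmetry k r q p"
  shows "i \<in> {1..k} \<Longrightarrow> \<exists>j\<in>{1..k}. p (Ev i) = Ev j \<or> p (Ev i) = Eh j"
    and "i \<in> {1..r} \<Longrightarrow> \<exists>j\<in>{1..r}. p (Uo i) = Uo j \<or> p (Uo i) = Vo j"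
    and "i \<in> {1..q} \<Longrightarrow> \<exists>j\<in>{1..q}. p (Zo i) = Zo j"
proof -
  have inj: "inj_on p (hbasis k r q)" and pZ: "p Zc = Zc"
    and E: "\<And>b. b \<in> hbasis_even k \<Longrightarrow> p b \<in> hbasis_even k"
    and O: "\<And>b. b \<in> hbasis_odd r q \<Longrightarrow> p b \<in> hbasis_odd r q"
    and P: "\<And>b. b \<in> hbasis k r q \<Longrightarrow> p (partner b) = partner (p b)"
    using p by (auto simp: pairing_symmetry_def)
  show "\<exists>j\<in>{1..k}. p (Ev i) = Ev j \<or> p (Ev i) = Eh j" if i: "i \<in> {1..k}"
  proof -
    have B: "Ev i \<in> hbasis_even k" "Ev i \<in> hbasis k r q"
      using i by (auto simp: hbasis_def hbasis_even_def)
    have "p (Ev i) \<noteq> Zc" using inj_onD[OF inj, of "Ev i" Zc] pZ B by auto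
    then show ?thesis using E[OF B(1)] by (auto simp: hbasis_even_def)
  qed
  show "\<exists>j\<in>{1..r}. p (Uo i) = Uo j \<or> p (Uo i) = Vo j" if i: "i \<in> {1..r}"
  proof -
    have B: "Uo i \<in> hbasis_odd r q" "Uo i \<in> hbasis k r q" "Vo i \<in> hbasis k r q"
      using i by (auto simp: hbasis_def hbasis_odd_def)
    have "partner (p (Uo i)) \<noteq> p (Uo i)"
      using inj_onD[OF inj, of "Uo i" "Vo i"] P[OF B(2)] B by auto
    then show ?thesis using O[OF B(1)] by (auto simp: hbasis_odd_def)
  qed
  show "\<exists>j\<in>{1..q}. p (Zo i) = Zo j" if i: "i \<in> {1..q}"
  proof -
    have B: "Zo i \<in> hbasis_odd r q" "Zo i \<in> hbasis k r q"
      using i by (auto simp: hbasis_def hbasis_odd_def)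
    have "partner (p (Zo i)) = p (Zo i)" using P[OF B(2)] by simp
    then show ?thesis using O[OF B(1)] by (auto simp: hbasis_odd_def)
  qed
qed

lemma permutation_of_indices:
  fixes C :: "nat \<Rightarrow> hgen"
  assumes p: "inj_on p (C ` {1..n})" and C: "inj C"
    and into: "\<And>i. i \<in> {1..n} \<Longrightarrow> \<exists>j\<in>{1..n}. p (C i) = C j"
  obtains \<sigma> where "\<sigma> permutes {1..n}" "\<And>i. i \<in> {1..n} \<Longrightarrow> p (C i) = C (\<sigma> i)"
proof -
  obtain s where s: "\<And>i. i \<in> {1..n} \<Longrightarrow> s i \<in> {1..n} \<and> p (C i) = C (s i)"
    using into by metis
  define \<sigma> where "\<sigma> i = (if i \<in> {1..n} then s i else i)" for i
  have \<sigma>: "\<sigma> i = s i" if "i \<in> {1..n}" for i using that by (simp add: \<sigma>_def)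
  have "inj_on \<sigma> {1..n}"
  proof (rule inj_onI)
    fix i j assume ij: "i \<in> {1..n}" "j \<in> {1..n}" "\<sigma> i = \<sigma> j"
    then have "p (C i) = p (C j)" using s by (simp add: \<sigma>)
    then have "C i = C j" using ij by (intro inj_onD[OF p, of "C i" "C j"]) auto
    then show "i = j" using C by (simp add: inj_eq)
  qed
  moreover have "\<sigma> ` {1..n} \<subseteq> {1..n}" using s \<sigma> by auto
  ultimately have "bij_betw \<sigma> {1..n} {1..n}" by (simp add: bij_betw_def endo_inj_surj)
  then have "\<sigma> permutes {1..n}" by (rule bij_imp_permutes) (auto simp: \<sigma>_def)
  then show ?thesis by (rule that) (use s \<sigma> in simp)
qed

text \<open>A symmetry that sends no \<open>Ev i\<close> to an \<open>Eh j\<close> and no \<open>Uo i\<close> to a \<open>Vo j\<close> is determined by its effect on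
  indices, since its values on the \<open>Eh i\<close> and \<open>Vo i\<close> are the partners of those on the
  \<open>Ev i\<close> and \<open>Uo i\<close>.\<close>

lemma unflipped_symmetry_is_relabel:
  assumes p: "pairing_symmetry k r q p"
    and Ev: "\<And>i. i \<in> {1..k} \<Longrightarrow> p (Ev i) \<notin> range Eh"
    and Uo: "\<And>i. i \<in> {1..r} \<Longrightarrow> p (Uo i) \<notin> range Vo"
  obtains \<sigma> \<tau> \<rho> where "\<sigma> permutes {1..k}" "\<tau> permutes {1..r}" "\<rho> permutes {1..q}"
    "\<And>b. b \<in> hbasis k r q \<Longrightarrow> p b = relabel \<sigma> \<tau> \<rho> b"
proof -
  have inj: "inj_on p (hbasis k r q)" and pZ: "p Zc = Zc"
    and P: "\<And>b. b \<in> hbasis k r q \<Longrightarrow> p (partner b) = partner (p b)"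
    using p by (auto simp: pairing_symmetry_def)
  note fam = pairing_symmetry_families[OF p]
  have sub: "Ev ` {1..k} \<subseteq> hbasis k r q" "Uo ` {1..r} \<subseteq> hbasis k r q" "Zo ` {1..q} \<subseteq> hbasis k r q"
    by (auto simp: hbasis_def hbasis_even_def hbasis_odd_def)
  obtain \<sigma> where \<sigma>: "\<sigma> permutes {1..k}" "\<And>i. i \<in> {1..k} \<Longrightarrow> p (Ev i) = Ev (\<sigma> i)"
    by (rule permutation_of_indices[OF inj_on_subset[OF inj sub(1)]])
      (use fam(1) Ev in \<open>fastforce simp: inj_on_def\<close>)+
  obtain \<tau> where \<tau>: "\<tau> permutes {1..r}" "\<And>i. i \<in> {1..r} \<Longrightarrow> p (Uo i) = Uo (\<tau> i)"
    by (rule permutation_of_indices[OF inj_on_subset[OF inj sub(2)]])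
      (use fam(2) Uo in \<open>fastforce simp: inj_on_def\<close>)+
  obtain \<rho> where \<rho>: "\<rho> permutes {1..q}" "\<And>i. i \<in> {1..q} \<Longrightarrow> p (Zo i) = Zo (\<rho> i)"
    by (rule permutation_of_indices[OF inj_on_subset[OF inj sub(3)]])
      (use fam(3) in \<open>auto simp: inj_on_def\<close>)
  have "p (Eh i) = Eh (\<sigma> i)" if "i \<in> {1..k}" for i
    using P[of "Ev i"] \<sigma>(2)[OF that] that by (simp add: hbasis_def hbasis_even_def)
  moreover have "p (Vo i) = Vo (\<tau> i)" if "i \<in> {1..r}" for i
    using P[of "Uo i"] \<tau>(2)[OF that] that by (simp add: hbasis_def hbasis_odd_def)
  ultimately have "p b = relabel \<sigma> \<tau> \<rho> b" if "b \<in> hbasis k r q" for b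
    using that \<sigma>(2) \<tau>(2) \<rho>(2) pZ by (auto simp: hbasis_def hbasis_even_def hbasis_odd_def)
  then show ?thesis using \<sigma>(1) \<tau>(1) \<rho>(1) that by blast
qed

lemma flip_conj_relabel:
  "flip (Ev i) = relabel (Transposition.transpose 1 i) id id \<circ> flip (Ev 1)
     \<circ> relabel (Transposition.transpose 1 i) id id"
  "flip (Uo j) = relabel id (Transposition.transpose 1 j) id \<circ> flip (Uo 1)
     \<circ> relabel id (Transposition.transpose 1 j) id"
proof -
  show "flip (Ev i) = relabel (Transposition.transpose 1 i) id id \<circ> flip (Ev 1)
     \<circ> relabel (Transposition.transpose 1 i) id id"
  proof
    fix b show "flip (Ev i) b = (relabel (Transposition.transpose 1 i) id id \<circ> flip (Ev 1)
     \<circ> relabel (Transposition.transpose 1 i) id id) b"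
      by (cases b) (auto simp: Transposition.transpose_def)
  qed
  show "flip (Uo j) = relabel id (Transposition.transpose 1 j) id \<circ> flip (Uo 1)
     \<circ> relabel id (Transposition.transpose 1 j) id"
  proof
    fix b show "flip (Uo j) b = (relabel id (Transposition.transpose 1 j) id \<circ> flip (Uo 1)
     \<circ> relabel id (Transposition.transpose 1 j) id) b"
      by (cases b) (auto simp: Transposition.transpose_def)
  qed
qed

text \<open>Induction on the set of pairs whose members \<open>p\<close> sends to the opposite kind: precomposing with
  the flip of one such pair removes it from the set, and when no pair is left \<open>p\<close> only relabels
  indices. Only the flips of the first pairs are assumed to be in \<open>R\<close>; the others are their
  conjugates. The closure condition \<open>cong\<close> discards the values outside the basis, on which a
  pairing symmetry is arbitrary.\<close>

lemma pairing_symmetry_generated: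
  assumes comp: "\<And>p p'. p \<in> R \<Longrightarrow> p' \<in> R \<Longrightarrow> p \<circ> p' \<in> R"
    and cong: "\<And>p p'. p \<in> R \<Longrightarrow> (\<And>b. b \<in> hbasis k r q \<Longrightarrow> p' b = p b) \<Longrightarrow> p' \<in> R"
    and flip_even: "k \<noteq> 0 \<Longrightarrow> flip (Ev 1) \<in> R" and flip_odd: "r \<noteq> 0 \<Longrightarrow> flip (Uo 1) \<in> R"
    and relabel_e: "\<And>\<sigma>. \<sigma> permutes {1..k} \<Longrightarrow> relabel \<sigma> id id \<in> R"
    and relabel_u: "\<And>\<tau>. \<tau> permutes {1..r} \<Longrightarrow> relabel id \<tau> id \<in> R"
    and relabel_z: "\<And>\<rho>. \<rho> permutes {1..q} \<Longrightarrow> relabel id id \<rho> \<in> R"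
    and p: "pairing_symmetry k r q p"
  shows "p \<in> R"
proof -
  define A where "A = Ev ` {1..k} \<union> Uo ` {1..r}"
  define flipped where "flipped p = {b \<in> A. p b \<in> range Eh \<union> range Vo}" for p :: "hgen \<Rightarrow> hgen"
  have flip_R: "flip b \<in> R" if "b \<in> A" for b
  proof -
    have "flip (Ev i) \<in> R" if "i \<in> {1..k}" for i
      unfolding flip_conj_relabel(1)[of i]
      using that by (intro comp relabel_e flip_even permutes_swap_id) auto
    moreover have "flip (Uo i) \<in> R" if "i \<in> {1..r}" for i
      unfolding flip_conj_relabel(2)[of i]
      using that by (intro comp relabel_u flip_odd permutes_swap_id) auto
    ultimately show ?thesis using that by (auto simp: A_def)
  qed
  have "finite (flipped p)" by (simp add: flipped_def A_def)
  then show ?thesis using p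
  proof (induction "flipped p" arbitrary: p rule: finite_psubset_induct)
    case psubset
    show ?case
    proof (cases "flipped p = {}")
      case True
      have unflipped: "p b \<notin> range Eh \<union> range Vo" if "b \<in> A" for b
        using True that by (auto simp: flipped_def)
      have "p (Ev i) \<notin> range Eh" if "i \<in> {1..k}" for i
        using unflipped[of "Ev i"] that by (simp add: A_def)
      moreover have "p (Uo i) \<notin> range Vo" if "i \<in> {1..r}" for i
        using unflipped[of "Uo i"] that by (simp add: A_def)
      ultimately obtain \<sigma> \<tau> \<rho> where perm: "\<sigma> permutes {1..k}" "\<tau> permutes {1..r}" "\<rho> permutes {1..q}"
        and eq: "\<And>b. b \<in> hbasis k r q \<Longrightarrow> p b = relabel \<sigma> \<tau> \<rho> b"
        using unflipped_symmetry_is_relabel[OF psubset.prems] by blast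
      have "relabel \<sigma> id id \<circ> (relabel id \<tau> id \<circ> relabel id id \<rho>) \<in> R"
        by (intro comp relabel_e relabel_u relabel_z perm)
      moreover have "(relabel \<sigma> id id \<circ> (relabel id \<tau> id \<circ> relabel id id \<rho>)) b = relabel \<sigma> \<tau> \<rho> b" for b
        by (cases b) auto
      ultimately show ?thesis using eq by (elim cong) simp
    next
      case False
      then obtain b where b: "b \<in> A" "p b \<in> range Eh \<union> range Vo" by (auto simp: flipped_def)
      have bB: "b \<in> hbasis k r q" and bZ: "b \<noteq> Zc"
        using b(1) by (auto simp: A_def hbasis_def hbasis_even_def hbasis_odd_def)
      \<comment> \<open>\<open>A\<close> contains one member of each pair, so the flip at \<open>b\<close> moves no other element of \<open>A\<close>.\<close>
      have other: "flip b c = c" if "c \<in> A" "c \<noteq> b" for c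
        using that b(1) by (auto simp: A_def Transposition.transpose_def)
      have at_b: "(p \<circ> flip b) b = partner (p b)"
        using psubset.prems bB by (simp add: pairing_symmetry_def)
      have "flipped (p \<circ> flip b) \<subseteq> flipped p"
        using other at_b b by (fastforce simp: flipped_def)
      moreover have "b \<in> flipped p" using b by (simp add: flipped_def)
      moreover have "b \<notin> flipped (p \<circ> flip b)"
        using b(2) at_b by (auto simp: flipped_def)
      ultimately have "flipped (p \<circ> flip b) \<subset> flipped p" by blast
      then have "p \<circ> flip b \<in> R"
        using psubset.hyps(2) pairing_symmetry_flip[OF psubset.prems bZ] by blast
      then have "(p \<circ> flip b) \<circ> flip b \<in> R" using comp flip_R[OF b(1)] by blast
      then show ?thesis by (elim cong) simp
    qed
  qed
qed

section \<open>Automorphisms of the grading as permutations of the basis\<close>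

text \<open>Only the values of \<open>p\<close> on the basis matter, so \<open>p\<close> may be replaced by any function that agrees
  with it there; the generators thus act as maps given by a formula on all of \<open>hgen\<close>.\<close>

definition acts_as ::
  "nat \<Rightarrow> nat \<Rightarrow> nat \<Rightarrow> ('a::comm_ring_1 hvec \<Rightarrow> 'a hvec) \<Rightarrow> (hgen \<Rightarrow> hgen) \<Rightarrow> bool" where
  "acts_as k r q f p \<longleftrightarrow> f \<in> carrier (hgrad_aut k r q) \<and>
     (\<forall>b\<in>hbasis k r q. f ` hspan {b} = hspan {p b})"

lemma hgrading_lines: "hgrading k r q = (\<lambda>b. hspan {b} :: 'a::comm_ring_1 hvec set) ` hbasis k r q"
  by (simp add: hgrading_eq hspan_singleton)

lemma hgrad_aut_image_hgrading:
  assumes "f \<in> carrier (hgrad_aut k r q)" "C \<in> hgrading k r q"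
  shows "f ` C \<in> hgrading k r q"
  using assms by (auto simp: hgrad_aut_def bij_betw_def)

lemma basis_vec_in_hspan [simp]: "basis_vec b \<in> (hspan B :: 'a::zero_neq_one hvec set) \<longleftrightarrow> b \<in> B"
  by (auto simp: hspan_def basis_vec_def)

lemma hspan_singleton_eq_iff [simp]:
  "(hspan {a} :: 'a::zero_neq_one hvec set) = hspan {b} \<longleftrightarrow> a = b"
proof
  assume "(hspan {a} :: 'a hvec set) = hspan {b}"
  moreover have "basis_vec a \<in> (hspan {a} :: 'a hvec set)" by simp
  ultimately have "basis_vec a \<in> (hspan {b} :: 'a hvec set)" by simp
  then show "a = b" by simp
qed simp

lemma acts_as_into:
  assumes "acts_as k r q (f :: 'a::comm_ring_1 hvec \<Rightarrow> 'a hvec) p" "b \<in> hbasis k r q"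
  shows "p b \<in> hbasis k r q"
proof -
  have "f ` hspan {b} \<in> hgrading k r q"
    using assms by (intro hgrad_aut_image_hgrading) (auto simp: acts_as_def hgrading_lines)
  then show ?thesis using assms by (auto simp: acts_as_def hgrading_lines)
qed

lemma acts_as_mult:
  assumes f: "acts_as k r q f p" and g: "acts_as k r q g p'"
  shows "acts_as k r q (f \<otimes>\<^bsub>hgrad_aut k r q\<^esub> g) (p \<circ> p')"
proof -
  have "f \<otimes>\<^bsub>hgrad_aut k r q\<^esub> g \<in> carrier (hgrad_aut k r q)"
    using f g group.is_monoid[OF group_hgrad_aut] by (auto simp: acts_as_def intro: monoid.m_closed)
  moreover have "(f \<otimes>\<^bsub>hgrad_aut k r q\<^esub> g) ` hspan {b} = hspan {p (p' b)}"
    if b: "b \<in> hbasis k r q" for b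
  proof -
    have "(f \<otimes>\<^bsub>hgrad_aut k r q\<^esub> g) ` hspan {b} = f ` (g ` hspan {b})"
      using f g b by (intro hgrad_aut_mult_image) (auto simp: acts_as_def hgrading_lines)
    then show ?thesis using f g b acts_as_into[OF g b] by (simp add: acts_as_def)
  qed
  ultimately show ?thesis by (simp add: acts_as_def)
qed

text \<open>If \<open>f\<close> and \<open>g\<close> move every homogeneous line in the same way, then \<open>f g\<^sup>-\<^sup>1\<close> leaves every line
  invariant, since each line is the image under \<open>g\<close> of some line.\<close>

lemma weyl_class_eqI:
  fixes f g :: "'a::comm_ring_1 hvec \<Rightarrow> 'a hvec"
  assumes f: "acts_as k r q f p" and g: "acts_as k r q g p"
  shows "weyl_class k r q f = weyl_class k r q g"
proof -
  let ?A = "hgrad_aut k r q :: ('a hvec \<Rightarrow> 'a hvec) monoid"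
    and ?S = "hgrad_stab k r q :: ('a hvec \<Rightarrow> 'a hvec) set"
  interpret A: group ?A by (rule group_hgrad_aut)
  interpret S: normal ?S ?A by (rule normal_hgrad_stab)
  have fA: "f \<in> carrier ?A" and gA: "g \<in> carrier ?A" using f g by (auto simp: acts_as_def)
  define h where "h = f \<otimes>\<^bsub>?A\<^esub> inv\<^bsub>?A\<^esub> g"
  have hA: "h \<in> carrier ?A" and hg: "h \<otimes>\<^bsub>?A\<^esub> g = f"
    using fA gA by (simp_all add: h_def A.m_assoc)
  have im: "(`) g ` hgrading k r q = hgrading k r q"
    using gA by (simp add: hgrad_aut_def bij_betw_def)
  have "h ` C = C" if C: "C \<in> hgrading k r q" for C
  proof -
    obtain D where D: "D \<in> hgrading k r q" "C = g ` D"
      using C im by (metis imageE)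
    have "h ` C = f ` D" using hgrad_aut_mult_image[OF hA gA D(1)] hg D(2) by simp
    also have "\<dots> = g ` D" using D(1) f g unfolding acts_as_def hgrading_lines by force
    finally show ?thesis using D(2) by simp
  qed
  then have "h \<in> ?S" unfolding hgrad_stab_def using hA by blast
  then have "f \<in> ?S #>\<^bsub>?A\<^esub> g" unfolding r_coset_def using hg by blast
  from A.repr_independence[OF this gA S.subgroup_axioms] show ?thesis
    unfolding weyl_class_def by (rule sym)
qed

text \<open>A homogeneous line is determined by any nonzero vector in it, so it is enough to locate the
  image of each basis vector.\<close>

lemma acts_asI:
  fixes f :: "'a::comm_ring_1 hvec \<Rightarrow> 'a hvec"
  assumes f: "f \<in> carrier (hgrad_aut k r q)"
    and img: "\<And>b. b \<in> hbasis k r q \<Longrightarrow> f (basis_vec b) \<in> hspan {p b}"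
    and nz: "\<And>b. b \<in> hbasis k r q \<Longrightarrow> f (basis_vec b) \<noteq> 0"
  shows "acts_as k r q f p"
proof -
  have "f ` hspan {b} = hspan {p b}" if b: "b \<in> hbasis k r q" for b
  proof -
    have "f ` hspan {b} \<in> hgrading k r q"
      using b by (intro hgrad_aut_image_hgrading[OF f]) (auto simp: hgrading_lines)
    then obtain c where c: "f ` hspan {b} = hspan {c}" by (auto simp: hgrading_lines)
    have "f (basis_vec b) \<in> f ` hspan {b}" by (intro imageI) simp
    then have "f (basis_vec b) \<in> hspan {c}" by (simp add: c)
    moreover obtain d where "f (basis_vec b) d \<noteq> 0" using nz[OF b] by (auto simp: fun_eq_iff)
    ultimately have "d = c" "d = p b" using img[OF b] unfolding hspan_def by blast+
    then show ?thesis using c by simp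
  qed
  then show ?thesis using f by (simp add: acts_as_def)
qed

lemma hbracket_scaled_basis_vec:
  fixes s t :: "'a::comm_ring_1"
  assumes "a \<in> hbasis k r q" "b \<in> hbasis k r q"
  shows "hbracket k r q (hscale s (basis_vec a)) (hscale t (basis_vec b))
    = hscale (s * t * hcoef a b) (basis_vec Zc)"
proof -
  have "(\<Sum>x\<in>hbasis k r q. \<Sum>y\<in>hbasis k r q.
      hscale s (basis_vec a) x * hscale t (basis_vec b) y * hcoef x y)
    = (\<Sum>x\<in>hbasis k r q. if x = a then
         (\<Sum>y\<in>hbasis k r q. if y = b then s * t * hcoef a b else 0) else 0)"
    by (intro sum.cong refl) (auto simp: hscale_def basis_vec_def intro!: sum.cong sum.neutral)
  also have "\<dots> = s * t * hcoef a b"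
    using assms by (simp add: hbasis_finite)
  finally show ?thesis
    by (auto simp: hbracket_apply hscale_def basis_vec_def)
qed

text \<open>Applying \<open>f\<close> to \<open>[a, b]\<close> multiplies the structure constant by a nonzero factor, and \<open>z\<close> is
  itself a product because \<open>k \<ge> 1\<close>; this is what forces \<open>p\<close> to fix \<open>z\<close> and to respect partners.\<close>

lemma acts_as_obtain:
  fixes f :: "'a::field hvec \<Rightarrow> 'a hvec"
  assumes f: "f \<in> carrier (hgrad_aut k r q)" and k: "k \<ge> 1"
  obtains p where "acts_as k r q f p" "pairing_symmetry k r q p"
proof -
  let ?B = "hbasis k r q" and ?H = "heis k r q :: 'a hvec set"
  have faut: "f \<in> haut k r q" and fG: "bij_betw ((`) f) (hgrading k r q) (hgrading k r q)"
    using f by (simp_all add: hgrad_aut_def)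
  have finj: "inj_on f ?H" using faut by (simp add: haut_def Bij_def bij_betw_def)
  have add: "\<And>x y. x \<in> ?H \<Longrightarrow> y \<in> ?H \<Longrightarrow> f (x + y) = f x + f y"
    and scale: "\<And>c x. x \<in> ?H \<Longrightarrow> f (hscale c x) = hscale c (f x)"
    and br: "\<And>x y. x \<in> ?H \<Longrightarrow> y \<in> ?H \<Longrightarrow> f (hbracket k r q x y) = hbracket k r q (f x) (f y)"
    and fE: "f ` hspan (hbasis_even k) \<subseteq> hspan (hbasis_even k)"
    and fO: "f ` hspan (hbasis_odd r q) \<subseteq> hspan (hbasis_odd r q)"
    using faut by (auto simp: haut_def hlinear_def)
  have zero: "0 \<in> ?H" by (simp add: hspan_def)
  have f0: "f 0 = 0" using add[OF zero zero] by simp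
  have "\<exists>c\<in>?B. f ` hspan {b} = hspan {c}" if "b \<in> ?B" for b
    using hgrad_aut_image_hgrading[OF f, of "hspan {b}"] that by (auto simp: hgrading_lines)
  then obtain p where pB: "\<And>b. b \<in> ?B \<Longrightarrow> p b \<in> ?B"
    and pf: "\<And>b. b \<in> ?B \<Longrightarrow> f ` hspan {b} = hspan {p b}" by metis
  have acts: "acts_as k r q f p" using f pf by (simp add: acts_as_def)
  have "\<exists>c. f (basis_vec b) = hscale c (basis_vec (p b))" if "b \<in> ?B" for b
  proof -
    have "f (basis_vec b) \<in> f ` hspan {b}" by (intro imageI) simp
    then show ?thesis using pf[OF that] by (auto simp: hspan_singleton)
  qed
  then obtain s where s: "\<And>b. b \<in> ?B \<Longrightarrow> f (basis_vec b) = hscale (s b) (basis_vec (p b))"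
    by metis
  have nz: "s b \<noteq> 0" if b: "b \<in> ?B" for b
  proof
    assume "s b = 0"
    then have "f (basis_vec b) = f 0" using s[OF b] f0 by (simp add: hscale_def fun_eq_iff)
    then have "basis_vec b = (0 :: 'a hvec)" using b zero by (intro inj_onD[OF finj, of "basis_vec b" 0]) auto
    then have "basis_vec b b = (0 :: 'a)" by simp
    then show False by (simp add: basis_vec_def)
  qed
  have inj: "inj_on p ?B"
  proof (rule inj_onI)
    fix a b assume ab: "a \<in> ?B" "b \<in> ?B" "p a = p b"
    then have "f ` hspan {a} = f ` hspan {b}" using pf by simp
    then have "(hspan {a} :: 'a hvec set) = hspan {b}"
      using ab fG by (intro inj_onD[of "(`) f" "hgrading k r q" "hspan {a}" "hspan {b}"]) (auto simp: bij_betw_def hgrading_lines)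
    then show "a = b" by simp
  qed
  have parity: "p b \<in> D" if D: "f ` hspan D \<subseteq> hspan D" and b: "b \<in> D" "b \<in> ?B" for b D
  proof -
    have "f (basis_vec b) \<in> hspan D" using D b(1) by (auto simp: image_subset_iff)
    then have "hscale (s b) (basis_vec (p b)) \<in> hspan D" unfolding s[OF b(2)] .
    then show ?thesis using nz[OF b(2)] by (auto simp: hspan_def hscale_def basis_vec_def)
  qed
  have product: "hscale (hcoef a b * s Zc) (basis_vec (p Zc))
      = hscale (s a * s b * hcoef (p a) (p b)) (basis_vec Zc)" if "a \<in> ?B" "b \<in> ?B" for a b
  proof -
    have "hscale (hcoef a b * s Zc) (basis_vec (p Zc)) = f (hscale (hcoef a b) (basis_vec Zc))"
      by (simp add: scale s) (simp add: hscale_def mult.assoc)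
    also have "hscale (hcoef a b) (basis_vec Zc)
        = hbracket k r q (basis_vec a) (basis_vec b :: 'a hvec)"
      using hbracket_scaled_basis_vec[OF that, of "1 :: 'a" 1] by (simp add: basis_vec_scale1)
    also have "f \<dots> = hbracket k r q (hscale (s a) (basis_vec (p a))) (hscale (s b) (basis_vec (p b)))"
      using that by (simp add: br s)
    also have "\<dots> = hscale (s a * s b * hcoef (p a) (p b)) (basis_vec Zc)"
      by (rule hbracket_scaled_basis_vec[OF pB[OF that(1)] pB[OF that(2)]])
    finally show ?thesis .
  qed
  have pZ: "p Zc = Zc"
  proof (rule ccontr)
    assume neq: "p Zc \<noteq> Zc"
    have "Ev 1 \<in> ?B" "Eh 1 \<in> ?B" using k by (auto simp: hbasis_def hbasis_even_def)
    from fun_cong[OF product[OF this], of "p Zc"] neq show False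
      using nz[OF Zc_in_hbasis] by (simp add: hscale_def basis_vec_def)
  qed
  have P: "p (partner a) = partner (p a)" if a: "a \<in> ?B" for a
  proof (cases "a = Zc")
    case False
    have "hcoef a (partner a) * s Zc = s a * s (partner a) * hcoef (p a) (p (partner a))"
      using fun_cong[OF product[of a "partner a"], of Zc] a pZ
      by (simp add: hscale_def basis_vec_def)
    moreover have "hcoef a (partner a) \<noteq> (0 :: 'a)" using False by (simp add: hcoef_nonzero_iff)
    ultimately have "hcoef (p a) (p (partner a)) \<noteq> (0 :: 'a)"
      using nz[OF Zc_in_hbasis] by (metis mult_eq_0_iff)
    then show ?thesis by (simp add: hcoef_nonzero_iff)
  qed (simp add: pZ)
  have "pairing_symmetry k r q p"
    using inj pZ P parity[OF fE] parity[OF fO] by (auto simp: pairing_symmetry_def hbasis_def)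
  then show ?thesis using acts that by blast
qed

section \<open>The permutations induced by the generators\<close>

lemma hlin_basis_vec:
  assumes "b \<in> hbasis k r q"
  shows "hlin k r q \<phi> (basis_vec b) = (\<phi> b :: 'a::comm_ring_1 hvec)"
proof
  fix c
  have "hlin k r q \<phi> (basis_vec b) c = (\<Sum>a\<in>hbasis k r q. basis_vec b a * \<phi> a c)"
    using assms by (intro hlin_apply) simp
  also have "\<dots> = (\<Sum>a\<in>hbasis k r q. if a = b then \<phi> b c else 0)"
    by (intro sum.cong refl) (auto simp: basis_vec_def)
  also have "\<dots> = \<phi> b c" using assms by (simp add: hbasis_finite)
  finally show "hlin k r q \<phi> (basis_vec b) c = \<phi> b c" .
qed

lemma acts_as_hlin:
  fixes \<phi> :: "hgen \<Rightarrow> 'a::comm_ring_1 hvec"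
  assumes "hlin k r q \<phi> \<in> carrier (hgrad_aut k r q)"
    and \<phi>: "\<And>b. b \<in> hbasis k r q \<Longrightarrow> \<phi> b = basis_vec (p b) \<or> \<phi> b = - basis_vec (p b)"
  shows "acts_as k r q (hlin k r q \<phi>) p"
proof (rule acts_asI[OF assms(1)])
  fix b assume b: "b \<in> hbasis k r q"
  show "hlin k r q \<phi> (basis_vec b) \<in> hspan {p b}"
    unfolding hlin_basis_vec[OF b] using \<phi>[OF b] by (auto simp: hspan_def basis_vec_def)
  have "\<phi> b (p b) \<noteq> 0" using \<phi>[OF b] by (auto simp: basis_vec_def)
  then show "hlin k r q \<phi> (basis_vec b) \<noteq> 0" unfolding hlin_basis_vec[OF b] by auto
qed

lemma acts_as_sigma_tilde:
  assumes "\<sigma> permutes {1..k}"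
  shows "acts_as k r q (sigma_tilde k r q \<sigma>) (relabel \<sigma> id id)"
  unfolding sigma_tilde_def using sigma_tilde_in_aut[OF assms]
  by (intro acts_as_hlin) (auto simp: sigma_tilde_def split: hgen.splits)

lemma acts_as_sigma_bar:
  assumes "\<sigma> permutes {1..r}"
  shows "acts_as k r q (sigma_bar k r q \<sigma>) (relabel id \<sigma> id)"
  unfolding sigma_bar_def using sigma_bar_in_aut[OF assms]
  by (intro acts_as_hlin) (auto simp: sigma_bar_def split: hgen.splits)

lemma acts_as_rho_hat:
  assumes "\<rho> permutes {1..q}"
  shows "acts_as k r q (rho_hat k r q \<rho>) (relabel id id \<rho>)"
  unfolding rho_hat_def using rho_hat_in_aut[OF assms]
  by (intro acts_as_hlin) (auto simp: rho_hat_def split: hgen.splits)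

lemma acts_as_mu:
  assumes "i \<in> {1..k}"
  shows "acts_as k r q (mu k r q i) (flip (Ev i))"
  unfolding mu_def using mu_in_aut[OF assms]
  by (intro acts_as_hlin) (auto simp: mu_def Transposition.transpose_def)

lemma acts_as_mu':
  assumes "i \<in> {1..r}"
  shows "acts_as k r q (mu' k r q i) (flip (Uo i))"
  unfolding mu'_def using mu'_in_aut[OF assms]
  by (intro acts_as_hlin) (auto simp: mu'_def Transposition.transpose_def)

section \<open>Generators of the Weyl group\<close>

lemma weyl_class_mult:
  assumes "f \<in> carrier (hgrad_aut k r q)" "g \<in> carrier (hgrad_aut k r q)"
  shows "weyl_class k r q f \<otimes>\<^bsub>weyl_group k r q\<^esub> weyl_class k r q g
    = weyl_class k r q (f \<otimes>\<^bsub>hgrad_aut k r q\<^esub> g)"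
  using normal.rcos_sum[OF normal_hgrad_stab assms] by (simp add: weyl_group_def weyl_class_def)

lemma carrier_weyl_group:
  "carrier (weyl_group k r q) = weyl_class k r q ` carrier (hgrad_aut k r q)"
  by (auto simp: weyl_group_def weyl_class_def carrier_FactGroup)

lemma group_weyl_group: "group (weyl_group k r q)"
  unfolding weyl_group_def by (rule normal.factorgroup_is_group[OF normal_hgrad_stab])

theorem proposition2:
  fixes k m r q :: nat
  assumes "CHAR('a::alg_closed_field) \<noteq> 2"
    and "k \<ge> 1" and "2 * r \<le> m" and "q = m - 2 * r"
  shows "generate (weyl_group k r q)
      ({weyl_class k r q (mu k r q 1)}
       \<union> (if r = 0 then {} else {weyl_class k r q (mu' k r q 1)})
       \<union> {weyl_class k r q (sigma_tilde k r q \<sigma>) | \<sigma>. \<sigma> permutes {1..k}}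
       \<union> {weyl_class k r q (sigma_bar k r q \<sigma>) | \<sigma>. \<sigma> permutes {1..r}}
       \<union> {weyl_class k r q (rho_hat k r q \<sigma>) | \<sigma>. \<sigma> permutes {1..q}})
    = carrier (weyl_group k r q :: ('a hvec \<Rightarrow> 'a hvec) set monoid)"
    (is "generate ?W ?X = _")
proof
  have "?X \<subseteq> carrier ?W"
    using \<open>k \<ge> 1\<close> by (auto simp: carrier_weyl_group intro!: imageI mu_in_aut mu'_in_aut
      sigma_tilde_in_aut sigma_bar_in_aut rho_hat_in_aut)
  then show "generate ?W ?X \<subseteq> carrier ?W" by (rule group.generate_incl[OF group_weyl_group])
next
  \<comment> \<open>The permutations induced by some automorphism whose class the generators reach.\<close>
  define R where "R = {p. \<exists>f. acts_as k r q (f :: 'a hvec \<Rightarrow> 'a hvec) p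
    \<and> weyl_class k r q f \<in> generate ?W ?X}"
  have RI: "p \<in> R" if "acts_as k r q (f :: 'a hvec \<Rightarrow> 'a hvec) p" "weyl_class k r q f \<in> ?X" for f p
    unfolding R_def mem_Collect_eq by (intro exI[of _ f] conjI generate.incl that)
  have R: "p \<in> R" if p: "pairing_symmetry k r q p" for p
  proof (rule pairing_symmetry_generated[OF _ _ _ _ _ _ _ p])
    fix p p' assume "p \<in> R" "p' \<in> R"
    then obtain f g :: "'a hvec \<Rightarrow> 'a hvec" where f: "acts_as k r q f p" and g: "acts_as k r q g p'"
      and gen: "weyl_class k r q f \<in> generate ?W ?X" "weyl_class k r q g \<in> generate ?W ?X"
      unfolding R_def by blast
    have "weyl_class k r q (f \<otimes>\<^bsub>hgrad_aut k r q\<^esub> g) \<in> generate ?W ?X"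
      using generate.eng[OF gen] f g by (simp add: weyl_class_mult acts_as_def)
    then show "p \<circ> p' \<in> R" using acts_as_mult[OF f g] unfolding R_def by blast
  next
    fix p p' assume "p \<in> R" and eq: "\<And>b. b \<in> hbasis k r q \<Longrightarrow> p' b = p b"
    then obtain f :: "'a hvec \<Rightarrow> 'a hvec"
      where f: "acts_as k r q f p" and gen: "weyl_class k r q f \<in> generate ?W ?X"
      unfolding R_def by blast
    have "acts_as k r q f p'" using f eq by (simp add: acts_as_def)
    then show "p' \<in> R" using gen unfolding R_def by blast
  next
    show "flip (Ev 1) \<in> R" using \<open>k \<ge> 1\<close> by (intro RI[OF acts_as_mu]) auto
  next
    assume "r \<noteq> 0"
    then show "flip (Uo 1) \<in> R" by (intro RI[OF acts_as_mu']) auto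
  next
    fix \<sigma> assume "\<sigma> permutes {1..k}"
    then show "relabel \<sigma> id id \<in> R" by (intro RI[OF acts_as_sigma_tilde]) auto
  next
    fix \<tau> assume "\<tau> permutes {1..r}"
    then show "relabel id \<tau> id \<in> R" by (intro RI[OF acts_as_sigma_bar]) auto
  next
    fix \<rho> assume "\<rho> permutes {1..q}"
    then show "relabel id id \<rho> \<in> R" by (intro RI[OF acts_as_rho_hat]) auto
  qed
  show "carrier ?W \<subseteq> generate ?W ?X"
  proof
    fix c assume "c \<in> carrier ?W"
    then obtain f where f: "f \<in> carrier (hgrad_aut k r q)" and c: "c = weyl_class k r q f"
      by (auto simp: carrier_weyl_group)
    obtain p where p: "acts_as k r q f p" "pairing_symmetry k r q p"
      using acts_as_obtain[OF f \<open>k \<ge> 1\<close>] by blast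
    obtain g where "acts_as k r q g p" "weyl_class k r q g \<in> generate ?W ?X"
      using R[OF p(2)] unfolding R_def by blast
    then show "c \<in> generate ?W ?X" using weyl_class_eqI[OF p(1)] c by simp
  qed
qed

end
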